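(* Let $n\ge2$, $1\le k\le n$, $k'=n+1-k$, and let $s_i(x):=e_i^{\gamma_i(x)^{-1}}(x)$ ($i\in I=\{0,1,\dots,n\}$) be the birational maps generating the action of the affine Weyl group $W(A_n^{(1)})$ on the geometric crystal $\mathcal V(A_n^{(1)})$. For $1\le i\le n$, with $a=\max(k-i+1,1)$, $b=\min(k,n-i+1)$ and $a\le p\le b$, set $$F^{(p)}_i:=\frac{x^{(p)}_i\,(x^{(a)}_i\cdots x^{(p-1)}_i)^2}{x^{(a)}_{i-1}x^{(a+1)}_{i-1}\cdots x^{(p)}_{i-1}\cdot x^{(a-1)}_{i+1}x^{(a)}_{i+1}\cdots x^{(p-1)}_{i+1}} .$$ Then for $i=1,\dots,n$, $$s_i(x)^{(l)}_m=\begin{cases}x^{(l)}_i\,\dfrac{\sum_{p=a}^{l-1}F^{(p)}_i+\sum_{p=l}^{b}\frac1{D^{(p)}_i}}{\sum_{p=a}^{l}F^{(p)}_i+\sum_{p=l+1}^{b}\frac1{D^{(p)}_i}}& \text{if } m=i,\\[2mm] x^{(l)}_m&\text{otherwise,}\end{cases}$$ and $$s_0(x)^{(l)}_m=\begin{cases}x^{(l)}_m\,\dfrac{U^{(l-1)}_m+x^{(1)}_nx^{(k)}_1V^{(l)}_m}{U^{(l)}_m+x^{(1)}_nx^{(k)}_1V^{(l+1)}_m}&\text{if }(l,m)\ne(1,n),\\[2mm] \dfrac1{x^{(k)}_1}&\text{if }(l,m)=(1,n).\end{cases}$$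
   Context: **Coordinates.** $S_1=\{(l,m)\in\mathbb Z^2:1\le l\le k<l+m\le n+1\}$, $S_2=\{(l,m)\in\mathbb Z^2:1\le l\le k\le l+m\le n\}$. $\mathcal V(A_n^{(1)})$ is identified, via its positive structure, with the torus of $x=(x^{(l)}_m)_{S_1}\in(\mathbb C^\times)^{kk'}$; $x^{(l)}_m=1$ for $(l,m)\notin S_1$. **Structure for $1\le i\le n$** (with $a,b$ as in the claim): $$D^{(l)}_i=\frac{x^{(l)}_i\prod_{j=l+1}^{b}(x^{(j)}_i)^2}{\prod_{j=l+1}^{b+1}x^{(j)}_{i-1}\prod_{j=l}^{b}x^{(j)}_{i+1}},\qquad \gamma_i=D^{(a)}_i\frac{x^{(a)}_i}{x^{(a)}_{i-1}x^{(a-1)}_{i+1}},$$ and $e_i^c(x)=x'$ with $x'^{(l)}_m=x^{(l)}_m$ for $m\neq i$, $x'^{(l)}_i=x^{(l)}_i\frac{\sum_{p=a}^{l-1}1/D^{(p)}_i+\sum_{p=l}^{b}c/D^{(p)}_i}{\sum_{p=a}^{l}1/D^{(p)}_i+\sum_{p=l+1}^{b}c/D^{(p)}_i}$. **Paths.** A path is a sequence of points of $S_1$ with steps $(i,j)\to(i,j+1)$ of weight $x^{(i)}_j/x^{(i)}_{j+1}$ or $(i,j)\to(i-1,j+1)$ of weight $1$; its weight is the product of step weights. $P_1[n,k]$ is the set of paths from $(k,1)$ to $(1,n)$. A path $p\in P_1[n,k]$ is above (resp. below) $(l,m)$ if every point $(l,j)$ of row $l$ on $p$ has $j>m$ (resp.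 $j<m$); the condition is vacuous for $l\in\{0,k+1\}$. $U^{(l)}_m$ (resp. $V^{(l)}_m$) is the sum of weights of the paths in $P_1[n,k]$ above (resp. below) $(l,m)$. **Structure for $i=0$.** For $(l,m)\in S_1$, $X^{(l)}_m(x)$ is the sum of weights of all paths from $(l,m)$ to $(1,n)$; $X^{(l)}_m:=1/x^{(1)}_n$ if $l+m=k$, $X^{(k+1)}_m:=1$. $\Sigma:(\mathbb C^\times)^{S_1}\to(\mathbb C^\times)^{S_2}$, $\Sigma(x)^{(l)}_m=x^{(l+1)}_mX^{(l)}_m/X^{(l+1)}_m$, is birational. With $y=\Sigma(x)$ ($y^{(l)}_m=1$ outside $S_2$): $\gamma_0(x)=\frac{(y^{(k)}_0)^2}{y^{(k-1)}_1y^{(k)}_1}$ and $e_0^c(x)=\Sigma^{-1}(y')$, where $y'$ is $y$ with $y^{(k)}_0$ replaced by $c\,y^{(k)}_0$. *)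

theory Defs
  imports Complex_Main
begin

text \<open>The coordinate x^(l)_m of a point is written \<open>x l m\<close>. Indices are integers, so that
  \<open>a - 1\<close>, \<open>i - 1\<close> etc. are never truncated and sums or products over empty ranges are empty.\<close>

type_synonym point = "int \<Rightarrow> int \<Rightarrow> complex"

definition S1 :: "int \<Rightarrow> int \<Rightarrow> (int \<times> int) set" where
  "S1 n k = {(l, m). 1 \<le> l \<and> l \<le> k \<and> k < l + m \<and> l + m \<le> n + 1}"

definition S2 :: "int \<Rightarrow> int \<Rightarrow> (int \<times> int) set" where
  "S2 n k = {(l, m). 1 \<le> l \<and> l \<le> k \<and> k \<le> l + m \<and> l + m \<le> n}"

definition torus :: "(int \<times> int) set \<Rightarrow> point set" where
  "torus S = {x. \<forall>l m. if (l, m) \<in> S then x l m \<noteq> 0 else x l m = 1}"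

text \<open>Regular functions on the torus, i.e. Laurent polynomials in the coordinates.\<close>

inductive regular_fun :: "(int \<times> int) set \<Rightarrow> (point \<Rightarrow> complex) \<Rightarrow> bool"
  for S :: "(int \<times> int) set" where
  const: "regular_fun S (\<lambda>x. c)"
| coord: "(l, m) \<in> S \<Longrightarrow> regular_fun S (\<lambda>x. x l m)"
| inv_coord: "(l, m) \<in> S \<Longrightarrow> regular_fun S (\<lambda>x. 1 / x l m)"
| add: "regular_fun S f \<Longrightarrow> regular_fun S g \<Longrightarrow> regular_fun S (\<lambda>x. f x + g x)"
| mult: "regular_fun S f \<Longrightarrow> regular_fun S g \<Longrightarrow> regular_fun S (\<lambda>x. f x * g x)"

text \<open>\<open>generically S P\<close>: the property \<open>P\<close> holds on a nonempty (hence dense) Zariski-open subset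
  of the torus; principal open sets suffice, as they form a basis. Two rational maps on the torus
  are equal iff they are generically defined and agree.

  Rational maps are written below as total functions with \<open>z / 0 = 0\<close>. Since 0 is not an
  admissible coordinate, a quotient of two regular functions is defined and a unit at \<open>x\<close> iff
  its totalized value is nonzero; membership of the image in the torus thus expresses that the
  map is defined at \<open>x\<close>.\<close>

definition generically :: "(int \<times> int) set \<Rightarrow> (point \<Rightarrow> bool) \<Rightarrow> bool" where
  "generically S P \<longleftrightarrow>
     (\<exists>f. regular_fun S f \<and> (\<exists>x\<in>torus S. f x \<noteq> 0) \<and> (\<forall>x\<in>torus S. f x \<noteq> 0 \<longrightarrow> P x))"

text \<open>The rows \<open>l\<close> with \<open>(l, i) \<in> S1 n k\<close> are those with \<open>row_lo k i \<le> l \<le> row_hi n k i\<close>.\<close>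

definition row_lo :: "int \<Rightarrow> int \<Rightarrow> int" where
  "row_lo k i = max (k - i + 1) 1"

definition row_hi :: "int \<Rightarrow> int \<Rightarrow> int \<Rightarrow> int" where
  "row_hi n k i = min k (n - i + 1)"

definition D :: "int \<Rightarrow> int \<Rightarrow> int \<Rightarrow> int \<Rightarrow> point \<Rightarrow> complex" where
  "D n k i l x = (let b = row_hi n k i in
     x l i * (\<Prod>j=l+1..b. (x j i)^2)
       / ((\<Prod>j=l+1..b+1. x j (i - 1)) * (\<Prod>j=l..b. x j (i + 1))))"

definition F :: "int \<Rightarrow> int \<Rightarrow> int \<Rightarrow> point \<Rightarrow> complex" where
  "F k i p x = (let a = row_lo k i in
     x p i * (\<Prod>j=a..p-1. x j i)^2
       / ((\<Prod>j=a..p. x j (i - 1)) * (\<Prod>j=a-1..p-1. x j (i + 1))))"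

fun step :: "int \<times> int \<Rightarrow> int \<times> int \<Rightarrow> bool" where
  "step (i, j) (i', j') \<longleftrightarrow> (i' = i \<or> i' = i - 1) \<and> j' = j + 1"

fun step_weight :: "point \<Rightarrow> int \<times> int \<Rightarrow> int \<times> int \<Rightarrow> complex" where
  "step_weight x (i, j) (i', j') = (if i' = i then x i j / x i (j + 1) else 1)"

fun path_weight :: "point \<Rightarrow> (int \<times> int) list \<Rightarrow> complex" where
  "path_weight x (p # q # ps) = step_weight x p q * path_weight x (q # ps)"
| "path_weight x _ = 1"

definition paths :: "int \<Rightarrow> int \<Rightarrow> int \<times> int \<Rightarrow> int \<times> int \<Rightarrow> (int \<times> int) list set" where
  "paths n k p q =
     {ps. ps \<noteq> [] \<and> hd ps = p \<and> last ps = q \<and> set ps \<subseteq> S1 n k \<and> successively step ps}"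

definition P1 :: "int \<Rightarrow> int \<Rightarrow> (int \<times> int) list set" where
  "P1 n k = paths n k (k, 1) (1, n)"

text \<open>For \<open>l = 0\<close> and \<open>l = k + 1\<close> the next two conditions are vacuous on \<open>P1 n k\<close>.\<close>

definition above :: "(int \<times> int) list \<Rightarrow> int \<Rightarrow> int \<Rightarrow> bool" where
  "above ps l m \<longleftrightarrow> (\<forall>j. (l, j) \<in> set ps \<longrightarrow> j > m)"

definition below :: "(int \<times> int) list \<Rightarrow> int \<Rightarrow> int \<Rightarrow> bool" where
  "below ps l m \<longleftrightarrow> (\<forall>j. (l, j) \<in> set ps \<longrightarrow> j < m)"

definition U :: "int \<Rightarrow> int \<Rightarrow> int \<Rightarrow> int \<Rightarrow> point \<Rightarrow> complex" where
  "U n k l m x = (\<Sum>ps\<in>{ps \<in> P1 n k. above ps l m}. path_weight x ps)"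

definition V :: "int \<Rightarrow> int \<Rightarrow> int \<Rightarrow> int \<Rightarrow> point \<Rightarrow> complex" where
  "V n k l m x = (\<Sum>ps\<in>{ps \<in> P1 n k. below ps l m}. path_weight x ps)"

definition X :: "int \<Rightarrow> int \<Rightarrow> int \<Rightarrow> int \<Rightarrow> point \<Rightarrow> complex" where
  "X n k l m x =
     (if l = k + 1 then 1
      else if l + m = k then 1 / x 1 n
      else \<Sum>ps\<in>paths n k (l, m) (1, n). path_weight x ps)"

definition Sig :: "int \<Rightarrow> int \<Rightarrow> point \<Rightarrow> point" where
  "Sig n k x = (\<lambda>l m.
     if (l, m) \<in> S2 n k then x (l + 1) m * X n k l m x / X n k (l + 1) m x else 1)"

definition Sig_dom :: "int \<Rightarrow> int \<Rightarrow> point set" where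
  "Sig_dom n k = {x \<in> torus (S1 n k). Sig n k x \<in> torus (S2 n k)}"

text \<open>\<open>Sig n k\<close> is injective on its domain of definition \<open>Sig_dom n k\<close>, so that its inverse rational
  map is the inverse function on the image.\<close>

definition Sig_inv :: "int \<Rightarrow> int \<Rightarrow> point \<Rightarrow> point" where
  "Sig_inv n k = the_inv_into (Sig_dom n k) (Sig n k)"

definition gam :: "int \<Rightarrow> int \<Rightarrow> int \<Rightarrow> point \<Rightarrow> complex" where
  "gam n k i x =
     (if i = 0 then
        (let y = Sig n k x in (y k 0)^2 / (y (k - 1) 1 * y k 1))
      else
        (let a = row_lo k i in D n k i a x * (x a i / (x a (i - 1) * x (a - 1) (i + 1)))))"

definition crys_e :: "int \<Rightarrow> int \<Rightarrow> int \<Rightarrow> complex \<Rightarrow> point \<Rightarrow> point" where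
  "crys_e n k i c x =
     (if i = 0 then
        (let y = Sig n k x in Sig_inv n k (\<lambda>l m. if (l, m) = (k, 0) then c * y k 0 else y l m))
      else
        (let a = row_lo k i; b = row_hi n k i in
         (\<lambda>l m. if (l, m) \<in> S1 n k \<and> m = i
           then x l i * ((\<Sum>p=a..l-1. 1 / D n k i p x) + (\<Sum>p=l..b. c / D n k i p x))
                  / ((\<Sum>p=a..l. 1 / D n k i p x) + (\<Sum>p=l+1..b. c / D n k i p x))
           else x l m)))"

definition refl_s :: "int \<Rightarrow> int \<Rightarrow> int \<Rightarrow> point \<Rightarrow> point" where
  "refl_s n k i x = crys_e n k i (inverse (gam n k i x)) x"

end

theory Submission
  imports Defs
begin

text \<open>For \<open>1 \<le> i\<close> the formula comes from multiplying numerator and denominator of \<open>e_i^c\<close> by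
  \<open>\<gamma>_i = 1 / c\<close>, since \<open>F^(p)_i = \<gamma>_i / D^(p)_i\<close>.

  For \<open>i = 0\<close>, let \<open>X\<close> and \<open>T\<close> be the sums of weights of the paths from \<open>(l, m)\<close>, respectively from
  \<open>(k, 1)\<close>, to \<open>(1, n)\<close>, and put \<open>t = x^(1)_n x^(k)_1\<close>, so that \<open>\<gamma>_0 = 1 / t\<close>. Under \<open>\<Sigma>\<close> the path recursion
  becomes linear in \<open>1 / X\<close>, namely
  \<open>1 / X^(l)_(m+1) - 1 / X^(l+1)_m = (y^(l)_m / y^(l)_(m+1)) / X^(l)_m\<close>. In particular \<open>\<Sigma>\<close> is injective,
  and \<open>e_0^c\<close> only changes the boundary values of this recursion. The new solution is \<open>Q / (t T X)\<close>, where
  \<open>Q^(l)_m = U^(l)_m + t V^(l+1)_m = T + (t - 1) V^(l+1)_m\<close>: a path is either above \<open>(l, m)\<close> or below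
  \<open>(l + 1, m)\<close>. That it is a solution reduces to
  \<open>X^(l)_m (V^(l)_(m+1) - V^(l)_m) = X^(l-1)_(m+1) (V^(l+1)_m - V^(l)_m)\<close>, where the two differences count the
  paths using the edge from \<open>(l, m)\<close> to \<open>(l - 1, m + 1)\<close>, respectively passing through \<open>(l, m)\<close>.\<close>

section \<open>Path sums\<close>

lemma successively_stepD:
  assumes "successively step ps" "i < length ps"
  shows "snd (ps ! i) = snd (hd ps) + int i"
  using assms
proof (induction ps arbitrary: i rule: induct_list012)
  case (3 p q ps)
  then show ?case
    by (cases i) (cases p; cases q; auto)+
qed auto

lemma successively_step_nth:
  assumes "successively step ps" "Suc i < length ps"
  shows "step (ps ! i) (ps ! Suc i)"
  using assms by (simp add: successively_conv_nth)

lemma length_paths: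
  assumes "ps \<in> paths n k p q"
  shows "int (length ps) = snd q - snd p + 1"
  using assms successively_stepD[of ps "length ps - 1"]
  by (auto simp: paths_def last_conv_nth hd_conv_nth Suc_le_eq of_nat_diff)

lemma finite_S1: "finite (S1 n k)"
  by (rule finite_subset[of _ "{1..k} \<times> {1..n}"]) (auto simp: S1_def)

lemma finite_paths: "finite (paths n k p q)"
proof (rule finite_subset)
  show "paths n k p q \<subseteq> {ps. set ps \<subseteq> S1 n k \<and> length ps = nat (snd q - snd p + 1)}"
    using length_paths[of _ n k p q] by (auto simp: paths_def) (metis nat_int)
qed (simp add: finite_lists_length_eq finite_S1)

definition path_sum :: "int \<Rightarrow> int \<Rightarrow> int \<times> int \<Rightarrow> int \<times> int \<Rightarrow> point \<Rightarrow> complex" where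
  "path_sum n k p q x = (\<Sum>ps\<in>paths n k p q. path_weight x ps)"

text \<open>Lets the recursion \<open>path_sum_cons\<close> run up to the boundary of
  \<open>S1\<close>: a neighbour outside contributes 0, whatever quotient of coordinates stands in
  front of it.\<close>

lemma path_sum_outside: "p \<notin> S1 n k \<Longrightarrow> path_sum n k p q x = 0"
proof -
  assume "p \<notin> S1 n k"
  then have "paths n k p q = {}"
    by (auto simp: paths_def) (metis hd_in_set subsetD)
  then show ?thesis by (simp add: path_sum_def)
qed

lemma paths_refl:
  assumes "p \<in> S1 n k"
  shows "paths n k p p = {[p]}"
proof -
  have "ps = [p]" if "ps \<in> paths n k p p" for ps
    using length_paths[OF that] that by (cases ps) (auto simp: paths_def)
  moreover have "[p] \<in> paths n k p p"
    using assms by (auto simp: paths_def)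
  ultimately show ?thesis by blast
qed

lemma path_sum_refl: "p \<in> S1 n k \<Longrightarrow> path_sum n k p p x = 1"
  by (simp add: path_sum_def paths_refl)

lemma paths_cons:
  assumes "(l, m) \<in> S1 n k" "(l, m) \<noteq> q"
  shows "paths n k (l, m) q =
    (#) (l, m) ` (paths n k (l, m + 1) q \<union> paths n k (l - 1, m + 1) q)"
proof (intro equalityI subsetI)
  fix ps assume ps: "ps \<in> paths n k (l, m) q"
  then obtain rs where rs: "ps = (l, m) # rs"
    by (cases ps) (auto simp: paths_def)
  with ps assms(2) have "rs \<noteq> []" by (auto simp: paths_def)
  then obtain r rs' where "rs = r # rs'" by (cases rs) auto
  with ps rs show "ps \<in> (#) (l, m) ` (paths n k (l, m + 1) q \<union> paths n k (l - 1, m + 1) q)"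
    by (cases r) (auto simp: paths_def)
next
  fix ps assume "ps \<in> (#) (l, m) ` (paths n k (l, m + 1) q \<union> paths n k (l - 1, m + 1) q)"
  then show "ps \<in> paths n k (l, m) q"
    using assms by (auto simp: paths_def successively_Cons)
qed

lemma path_weight_append:
  assumes "as \<noteq> []" "bs \<noteq> []"
  shows "path_weight x (as @ bs) = path_weight x as * step_weight x (last as) (hd bs) * path_weight x bs"
  using assms
proof (induction as rule: induct_list012)
  case (2 p)
  then show ?case by (cases bs) auto
qed auto

lemma path_sum_cons:
  assumes "(l, m) \<in> S1 n k" "(l, m) \<noteq> q"
  shows "path_sum n k (l, m) q x =
    x l m / x l (m + 1) * path_sum n k (l, m + 1) q x + path_sum n k (l - 1, m + 1) q x"
proof -
  have "paths n k (l, m + 1) q \<inter> paths n k (l - 1, m + 1) q = {}"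
    by (auto simp: paths_def)
  moreover have w: "path_weight x ((l, m) # ps) =
      step_weight x (l, m) r * path_weight x ps" if "ps \<in> paths n k r q" for ps r
    using that by (cases ps) (auto simp: paths_def)
  ultimately show ?thesis
    unfolding path_sum_def paths_cons[OF assms]
    by (subst sum.reindex)
      (auto simp: sum.union_disjoint finite_paths sum_distrib_left w simp del: step_weight.simps path_weight.simps
        cong: sum.cong, simp)
qed

text \<open>A path in \<open>P1 n k\<close> meets each column \<open>1 \<le> m \<le> n\<close> exactly once, in the row given here.\<close>

definition row_at :: "(int \<times> int) list \<Rightarrow> int \<Rightarrow> int" where
  "row_at ps m = fst (ps ! nat (m - 1))"

context
  fixes n k :: int and ps
  assumes ps: "ps \<in> P1 n k"
begin

lemma length_P1: "int (length ps) = n"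
  using length_paths[of ps n k "(k, 1)" "(1, n)"] ps by (simp add: P1_def)

lemma P1_nth: "1 \<le> m \<Longrightarrow> m \<le> n \<Longrightarrow> ps ! nat (m - 1) = (row_at ps m, m)"
  using successively_stepD[of ps "nat (m - 1)"] length_P1 ps
  by (auto simp: P1_def paths_def row_at_def prod_eq_iff)

lemma in_P1_iff: "(l, j) \<in> set ps \<longleftrightarrow> 1 \<le> j \<and> j \<le> n \<and> row_at ps j = l"
proof
  assume "(l, j) \<in> set ps"
  then obtain i where i: "i < length ps" "ps ! i = (l, j)"
    by (auto simp: in_set_conv_nth)
  then have "j = 1 + int i"
    using successively_stepD[of ps i] ps by (auto simp: P1_def paths_def)
  then show "1 \<le> j \<and> j \<le> n \<and> row_at ps j = l"
    using i length_P1 by (auto simp: row_at_def)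
next
  assume j: "1 \<le> j \<and> j \<le> n \<and> row_at ps j = l"
  then have "nat (j - 1) < length ps"
    using length_P1 by linarith
  then show "(l, j) \<in> set ps"
    using P1_nth[of j] j nth_mem by fastforce
qed

lemma row_at_S1: "1 \<le> m \<Longrightarrow> m \<le> n \<Longrightarrow> (row_at ps m, m) \<in> S1 n k"
  using in_P1_iff[of "row_at ps m" m] ps by (auto simp: P1_def paths_def)

lemma row_at_1: "row_at ps 1 = k"
  using ps by (auto simp: P1_def paths_def row_at_def hd_conv_nth)

lemma row_at_n: "row_at ps n = 1"
proof -
  have "nat (n - 1) = length ps - 1" using length_P1 by linarith
  then show ?thesis using ps by (auto simp: P1_def paths_def row_at_def last_conv_nth)
qed

lemma row_at_Suc:
  assumes "1 \<le> m" "m < n"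
  shows "row_at ps (m + 1) = row_at ps m \<or> row_at ps (m + 1) = row_at ps m - 1"
proof -
  have e: "nat (m + 1 - 1) = Suc (nat (m - 1))" using assms by linarith
  have "step (ps ! nat (m - 1)) (ps ! Suc (nat (m - 1)))"
    using successively_step_nth[of ps "nat (m - 1)"] ps length_P1 assms
    by (auto simp: P1_def paths_def)
  then show ?thesis
    using P1_nth[of m] P1_nth[of "m + 1"] assms unfolding e by auto
qed

lemma row_at_antimono:
  assumes "1 \<le> i" "i \<le> j" "j \<le> n"
  shows "row_at ps j \<le> row_at ps i"
  using assms(2,1,3)
proof (induction j rule: int_ge_induct)
  case (step j)
  then show ?case using row_at_Suc[of j] by auto
qed auto

text \<open>A discrete intermediate value theorem: from one column to the next the row drops by at
  most one, so no row is skipped.\<close>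

lemma row_at_ivt:
  assumes "1 \<le> i" "i \<le> j" "j \<le> n" "row_at ps j \<le> l" "l \<le> row_at ps i"
  shows "\<exists>m. i \<le> m \<and> m \<le> j \<and> row_at ps m = l"
  using assms(2,1,3,4,5)
proof (induction j rule: int_ge_induct)
  case base
  then show ?case by (intro exI[of _ i]) auto
next
  case (step j)
  show ?case
  proof (cases "row_at ps j \<le> l")
    case True
    then show ?thesis using step by fastforce
  next
    case False
    then have "row_at ps (j + 1) = l" using row_at_Suc[of j] step by auto
    then show ?thesis using step by (intro exI[of _ "j + 1"]) auto
  qed
qed

text \<open>Reduces a condition on a whole row to one column. If the path is in a row \<ge> l at
  column m, then on its way down to row 1 it still has to meet row l, at a column \<ge> m; the
  converse is monotonicity. For \<open>above_iff\<close> the argument runs backwards to the start in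
  row k.\<close>

lemma below_iff:
  assumes "1 \<le> m" "m \<le> n" "1 \<le> l"
  shows "below ps l m \<longleftrightarrow> row_at ps m < l"
proof
  assume "below ps l m"
  then show "row_at ps m < l"
    using row_at_ivt[of m n l] assms in_P1_iff row_at_n unfolding below_def by fastforce
next
  assume "row_at ps m < l"
  then show "below ps l m"
    using row_at_antimono[of m] assms in_P1_iff unfolding below_def by (metis not_le)
qed

lemma above_iff:
  assumes "1 \<le> m" "m \<le> n" "l \<le> k"
  shows "above ps l m \<longleftrightarrow> l < row_at ps m"
proof
  assume "above ps l m"
  then show "l < row_at ps m"
    using row_at_ivt[of 1 m l] assms in_P1_iff row_at_1 unfolding above_def by fastforce
next
  assume "l < row_at ps m"
  then show "above ps l m"
    using row_at_antimono[of _ m] assms in_P1_iff unfolding above_def by (metis not_le)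
qed

end

section \<open>Splitting the sums over \<open>P1\<close> by rows and edges\<close>

lemma finite_P1: "finite (P1 n k)"
  by (simp add: P1_def finite_paths)

lemma V_eq:
  assumes "1 \<le> m" "m \<le> n" "1 \<le> l"
  shows "V n k l m x = (\<Sum>ps\<in>{ps \<in> P1 n k. row_at ps m < l}. path_weight x ps)"
  unfolding V_def using below_iff[OF _ assms] by (intro sum.cong) auto

lemma U_plus_V:
  assumes "1 \<le> m" "m \<le> n" "0 \<le> l" "l \<le> k"
  shows "U n k l m x + V n k (l + 1) m x = path_sum n k (k, 1) (1, n) x"
proof -
  have "P1 n k = {ps \<in> P1 n k. above ps l m} \<union> {ps \<in> P1 n k. below ps (l + 1) m}"
    using above_iff[OF _ assms(1,2,4)] below_iff[OF _ assms(1,2), of _ k "l + 1"] assms by force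
  moreover have "{ps \<in> P1 n k. above ps l m} \<inter> {ps \<in> P1 n k. below ps (l + 1) m} = {}"
    using above_iff[OF _ assms(1,2,4)] below_iff[OF _ assms(1,2), of _ k "l + 1"] assms by force
  ultimately show ?thesis
    unfolding U_def V_def path_sum_def P1_def[symmetric]
    by (metis (no_types, lifting) finite_P1 finite_Un sum.union_disjoint)
qed

text \<open>Cutting a path at the given edge is a bijection onto pairs of paths, and the weight is
  multiplicative under concatenation.\<close>

lemma sum_paths_through_edge:
  assumes "1 \<le> m" "m < n" "l' = l \<or> l' = l - 1"
  shows "(\<Sum>ps\<in>{ps \<in> P1 n k. row_at ps m = l \<and> row_at ps (m + 1) = l'}. path_weight x ps) =
    path_sum n k (k, 1) (l, m) x * step_weight x (l, m) (l', m + 1)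
      * path_sum n k (l', m + 1) (1, n) x"
    (is "sum _ ?A = _")
proof -
  let ?B = "paths n k (k, 1) (l, m) \<times> paths n k (l', m + 1) (1, n)"
  have len: "length as = nat m" if "as \<in> paths n k (k, 1) (l, m)" for as
    using length_paths[OF that] by simp
  have "sum (path_weight x) ?A = (\<Sum>(as, bs)\<in>?B. path_weight x (as @ bs))"
  \<comment> \<open>List position m - 1 holds the point in column m, so the prefix of length m is
    the part ending at (l, m).\<close>
  proof (rule sum.reindex_bij_witness[of _ "\<lambda>(as, bs). as @ bs" "\<lambda>ps. (take (nat m) ps, drop (nat m) ps)"])
    fix ps assume A: "ps \<in> ?A"
    then have P: "ps \<in> P1 n k" by simp
    have e: "nat (m + 1 - 1) = nat m" by simp
    have lp: "int (length ps) = n" using length_P1[OF P] .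
    have 1: "ps ! nat (m - 1) = (l, m)" "ps ! nat m = (l', m + 1)"
      using P1_nth[OF P, of m] P1_nth[OF P, of "m + 1"] A assms by (auto simp: e)
    have 2: "last (take (nat m) ps) = (l, m)"
      using 1 lp assms by (subst last_conv_nth) (auto simp: min_def nat_diff_distrib)
    have 3: "hd (drop (nat m) ps) = (l', m + 1)"
      using 1 lp assms by (subst hd_drop_conv_nth) auto
    have "successively step (take (nat m) ps @ drop (nat m) ps)"
      using P by (simp add: P1_def paths_def)
    then show "(take (nat m) ps, drop (nat m) ps) \<in> ?B"
      using P 2 3 lp assms unfolding successively_append_iff
      by (auto simp: P1_def paths_def hd_take dest: in_set_takeD in_set_dropD)
  next
    fix ab assume B: "ab \<in> ?B"
    then obtain as bs where ab: "ab = (as, bs)" "as \<in> paths n k (k, 1) (l, m)"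
      "bs \<in> paths n k (l', m + 1) (1, n)" by auto
    then have P: "as @ bs \<in> P1 n k"
      using assms(3) by (auto simp: P1_def paths_def successively_append_iff)
    have la: "length as = nat m" using ab len by auto
    have "as ! nat (m - 1) = (l, m)"
      using ab la assms by (auto simp: paths_def last_conv_nth nat_diff_distrib)
    moreover have "bs ! 0 = (l', m + 1)"
      using ab by (auto simp: paths_def hd_conv_nth)
    ultimately show "(\<lambda>(as, bs). as @ bs) ab \<in> ?A"
      using P ab la assms by (auto simp: row_at_def nth_append)
  next
    fix ab assume "ab \<in> ?B"
    then show "(\<lambda>ps. (take (nat m) ps, drop (nat m) ps)) ((\<lambda>(as, bs). as @ bs) ab) = ab"
      using len by auto
  qed auto
  also have "\<dots> = (\<Sum>(as, bs)\<in>?B. path_weight x as * step_weight x (l, m) (l', m + 1) * path_weight x bs)"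
    by (intro sum.cong) (auto simp: paths_def path_weight_append)
  also have "\<dots> = path_sum n k (k, 1) (l, m) x * step_weight x (l, m) (l', m + 1)
      * path_sum n k (l', m + 1) (1, n) x"
    unfolding path_sum_def sum_distrib_right sum_distrib_left
    by (subst sum.cartesian_product[symmetric], subst sum.swap) (rule refl)
  finally show ?thesis .
qed

text \<open>Both differences have the path sum \<open>?G\<close> from (k, 1) to (l, m) as a factor;
  comparing the cofactors gives the claim without dividing by \<open>?G\<close>.\<close>

lemma V_exchange:
  assumes lm: "(l, m) \<in> S1 n k" "(l, m) \<noteq> (1, n)"
  shows "path_sum n k (l, m) (1, n) x * (V n k l (m + 1) x - V n k l m x) =
    path_sum n k (l - 1, m + 1) (1, n) x * (V n k (l + 1) m x - V n k l m x)"
proof -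
  have m: "1 \<le> m" "m < n" "1 \<le> l"
    using lm by (auto simp: S1_def)
  let ?E = "\<lambda>l'. {ps \<in> P1 n k. row_at ps m = l \<and> row_at ps (m + 1) = l'}"
  let ?G = "path_sum n k (k, 1) (l, m) x"
  have fin: "finite {ps \<in> P1 n k. P ps}" for P
    using finite_P1[of n k] by auto
  have steps: "row_at ps (m + 1) = row_at ps m \<or> row_at ps (m + 1) = row_at ps m - 1"
    if "ps \<in> P1 n k" for ps
    using row_at_Suc[OF that] m by auto
  \<comment> \<open>A path that gets below row l only at column m + 1 must take the diagonal edge
    out of (l, m).\<close>
  have "{ps \<in> P1 n k. row_at ps (m + 1) < l} = {ps \<in> P1 n k. row_at ps m < l} \<union> ?E (l - 1)"
    using steps by force
  moreover have "{ps \<in> P1 n k. row_at ps m < l} \<inter> ?E (l - 1) = {}"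
    by auto
  ultimately have "V n k l (m + 1) x = V n k l m x + sum (path_weight x) (?E (l - 1))"
    using m by (simp add: V_eq sum.union_disjoint fin)
  then have 1: "V n k l (m + 1) x - V n k l m x = ?G * path_sum n k (l - 1, m + 1) (1, n) x"
    using m by (simp add: sum_paths_through_edge)
  have "{ps \<in> P1 n k. row_at ps m < l + 1} =
      {ps \<in> P1 n k. row_at ps m < l} \<union> (?E l \<union> ?E (l - 1))"
    using steps by force
  moreover have "{ps \<in> P1 n k. row_at ps m < l} \<inter> (?E l \<union> ?E (l - 1)) = {}" "?E l \<inter> ?E (l - 1) = {}"
    by auto
  ultimately have "V n k (l + 1) m x =
      V n k l m x + (sum (path_weight x) (?E l) + sum (path_weight x) (?E (l - 1)))"
    using m by (simp add: V_eq sum.union_disjoint fin)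
  \<comment> \<open>The contributions of the two edges out of (l, m) recombine to the path sum at
    (l, m) by \<open>path_sum_cons\<close>.\<close>
  then have "V n k (l + 1) m x - V n k l m x = ?G * path_sum n k (l, m) (1, n) x"
    using sum_paths_through_edge[OF m(1,2), where l = l and l' = l]
      sum_paths_through_edge[OF m(1,2), where l = l and l' = "l - 1"]
    by (simp add: path_sum_cons[OF lm] ring_distribs)
  with 1 show ?thesis by simp
qed

section \<open>The map \<open>\<Sigma>\<close> and the reflection at \<open>i = 0\<close>\<close>

lemma torus_ne0: "x \<in> torus S \<Longrightarrow> x l m \<noteq> 0"
  by (auto simp: torus_def) (metis zero_neq_one)

lemma X_eq_path_sum: "(l, m) \<in> S1 n k \<Longrightarrow> X n k l m x = path_sum n k (l, m) (1, n) x"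
  by (auto simp: X_def path_sum_def S1_def)

text \<open>In the formula for s_0 the denominator at (l, m) is Q^(l)_m and the numerator is
  Q^(l-1)_m.\<close>

definition Q :: "int \<Rightarrow> int \<Rightarrow> int \<Rightarrow> int \<Rightarrow> point \<Rightarrow> complex" where
  "Q n k l m x = U n k l m x + x 1 n * x k 1 * V n k (l + 1) m x"

section \<open>Boundary values and recursion of the path sums and of \<open>Q\<close>\<close>

locale crystal =
  fixes n k :: int
  assumes k: "1 \<le> k" "k \<le> n"
begin

abbreviation "PS l m x \<equiv> path_sum n k (l, m) (1, n) x"

lemma corner_S1: "(1, n) \<in> S1 n k" "(k, 1) \<in> S1 n k"
  using k by (auto simp: S1_def)

text \<open>On the last antidiagonal only diagonal steps stay inside \<open>S1\<close>, and these
  have weight 1.\<close>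

lemma path_sum_last:
  assumes "1 \<le> l" "l \<le> k" "l + m = n + 1"
  shows "PS l m x = 1"
  using assms
proof (induction l arbitrary: m rule: int_ge_induct)
  case base
  then have "m = n" by simp
  then show ?case using corner_S1 by (simp add: path_sum_refl)
next
  case (step l)
  then have "(l + 1, m) \<in> S1 n k" "(l + 1, m + 1) \<notin> S1 n k"
    using k by (auto simp: S1_def)
  then show ?case
    using step.IH[of "m + 1"] step.prems step.hyps path_sum_cons[of "l + 1" m n k "(1, n)" x]
    by (simp add: path_sum_outside)
qed

text \<open>Only the horizontal path is left in row 1, and its weight telescopes.\<close>

lemma path_sum_row_1:
  assumes x: "x \<in> torus (S1 n k)" and m: "k \<le> m" "m \<le> n"
  shows "PS 1 m x = x 1 m / x 1 n"
  using m(2,1)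
proof (induction m rule: int_le_induct)
  case base
  have "x 1 n \<noteq> 0" using x corner_S1 by (auto simp: torus_def)
  then show ?case using corner_S1 by (simp add: path_sum_refl)
next
  case (step m)
  then have s: "(1, m - 1) \<in> S1 n k" "(1, m) \<in> S1 n k" "(0, m) \<notin> S1 n k"
    using k by (auto simp: S1_def)
  moreover from this have "x 1 m \<noteq> 0" using x by (auto simp: torus_def)
  ultimately show ?case
    using path_sum_cons[of 1 "m - 1" n k "(1, n)" x] step by (simp add: path_sum_outside)
qed

lemma Q_eq:
  assumes "1 \<le> m" "m \<le> n" "0 \<le> l" "l \<le> k"
  shows "Q n k l m x = PS k 1 x + (x 1 n * x k 1 - 1) * V n k (l + 1) m x"
  using U_plus_V[OF assms, of x] by (simp add: Q_def algebra_simps)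

text \<open>In column m every path lies in a row between max(1, k + 1 - m) and min(k, n + 1 - m).
  With \<open>V_none\<close> and \<open>Q_eq\<close> this gives the boundary values of
  \<open>Q\<close>: t T at the upper end of a column and T at the lower end, where T =
  \<open>PS k 1 x\<close> and t = x^(1)_n x^(k)_1.\<close>

lemma V_all:
  assumes "1 \<le> m" "m \<le> n" "n < l + m \<or> l = k"
  shows "V n k (l + 1) m x = PS k 1 x"
proof -
  have l: "0 < l" using assms k by auto
  have "{ps \<in> P1 n k. row_at ps m < l + 1} = P1 n k"
    using row_at_S1[of _ n k m] assms by (fastforce simp: S1_def)
  then show ?thesis
    using V_eq[OF assms(1,2), of "l + 1"] l by (simp add: path_sum_def P1_def)
qed

lemma V_none:
  assumes "1 \<le> m" "m \<le> n" "0 \<le> l" "l + m \<le> k \<or> l = 0"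
  shows "V n k (l + 1) m x = 0"
proof -
  have "{ps \<in> P1 n k. row_at ps m < l + 1} = {}"
    using row_at_S1[of _ n k m] assms by (fastforce simp: S1_def)
  then have "(\<Sum>ps\<in>{ps \<in> P1 n k. row_at ps m < l + 1}. path_weight x ps) = 0"
    by (simp only: sum.empty)
  then show ?thesis
    using V_eq[OF assms(1,2), of "l + 1"] assms(3) by simp
qed

lemma Q_exchange:
  assumes lm: "(l, m) \<in> S1 n k" "(l, m) \<noteq> (1, n)"
  shows "PS l m x * Q n k (l - 1) (m + 1) x =
    x l m / x l (m + 1) * PS l (m + 1) x * Q n k (l - 1) m x + PS (l - 1) (m + 1) x * Q n k l m x"
proof -
  have b: "1 \<le> m" "m < n" "1 \<le> l" "l \<le> k"
    using lm by (auto simp: S1_def)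
  define w where "w = x l m / x l (m + 1)"
  define c where "c = x 1 n * x k 1 - 1"
  define T where "T = PS k 1 x"
  define A where "A = PS l (m + 1) x"
  define B where "B = PS (l - 1) (m + 1) x"
  define v0 where "v0 = V n k l m x"
  define v1 where "v1 = V n k (l + 1) m x"
  define v2 where "v2 = V n k l (m + 1) x"
  have Q: "Q n k (l - 1) (m + 1) x = T + c * v2" "Q n k (l - 1) m x = T + c * v0"
      "Q n k l m x = T + c * v1"
    using b Q_eq[of "m + 1" "l - 1" x] Q_eq[of m "l - 1" x] Q_eq[of m l x]
    by (auto simp: c_def T_def v0_def v1_def v2_def)
  have P: "PS l m x = w * A + B"
    using path_sum_cons[OF lm] by (simp add: w_def A_def B_def)
  \<comment> \<open>\<open>V_exchange\<close> is linear in V; scaling it by c and adding the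
    multiple T of \<open>P\<close> turns each V into the corresponding Q.\<close>
  have "(w * A + B) * (v2 - v0) = B * (v1 - v0)"
    using V_exchange[OF lm, of x] P by (simp add: B_def v0_def v1_def v2_def)
  then have "(w * A + B) * (T + c * v2) = w * A * (T + c * v0) + B * (T + c * v1)"
    by algebra
  then show ?thesis
    unfolding Q P by (simp add: w_def A_def B_def)
qed

section \<open>The candidate for s_0 and its path sums\<close>

definition transf :: "point \<Rightarrow> point" where
  "transf x = (\<lambda>l m. if (l, m) \<in> S1 n k then x l m * (Q n k (l - 1) m x / Q n k l m x) else 1)"

definition good :: "point \<Rightarrow> bool" where
  "good x \<longleftrightarrow> x \<in> torus (S1 n k) \<and>
     (\<forall>(l, m)\<in>S1 n k. PS l m x \<noteq> 0 \<and> Q n k l m x \<noteq> 0 \<and> Q n k (l - 1) m x \<noteq> 0)"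

lemma good_T: "good x \<Longrightarrow> PS k 1 x \<noteq> 0"
  using corner_S1 by (auto simp: good_def)

lemma good_t: "good x \<Longrightarrow> x 1 n \<noteq> 0 \<and> x k 1 \<noteq> 0"
  using corner_S1 by (auto simp: good_def torus_def)

text \<open>At (1, n) the quotient of the Q is T / (t T), so the exceptional case of the theorem is
  an instance of the uniform formula.\<close>

lemma transf_corner:
  assumes "good x"
  shows "transf x 1 n = 1 / x k 1"
proof -
  have "V n k (0 + 1) n x = 0" "V n k (1 + 1) n x = PS k 1 x"
    using k V_none[of n 0 x] V_all[of n 1 x] by auto
  then have "Q n k 0 n x = PS k 1 x" "Q n k 1 n x = x 1 n * x k 1 * PS k 1 x"
    using k Q_eq[of n 0 x] Q_eq[of n 1 x] by (auto simp: algebra_simps)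
  then show ?thesis
    using good_T[OF assms] good_t[OF assms] corner_S1 by (simp add: transf_def)
qed

text \<open>Induction on the distance to column n: by \<open>Q_exchange\<close> the right-hand side
  satisfies the path recursion of the new point, and the constant t T normalises it to 1 at (1,
  n).\<close>

lemma path_sum_transf:
  assumes x: "good x" and lm: "(l, m) \<in> S1 n k"
  shows "PS l m (transf x) = PS l m x * (x 1 n * x k 1 * PS k 1 x) / Q n k l m x"
  using lm
proof (induction "nat (n - m)" arbitrary: l m rule: less_induct)
  case less
  note lm = less.prems
  note T = good_T[OF x] good_t[OF x]
  define C where "C = x 1 n * x k 1 * PS k 1 x"
  show ?case
  proof (cases "(l, m) = (1, n)")
    case True
    have "V n k (1 + 1) n x = PS k 1 x"
      using k V_all[of n 1 x] by auto
    then have "Q n k 1 n x = C"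
      using k Q_eq[of n 1 x] by (auto simp: algebra_simps C_def)
    then show ?thesis
      using True T corner_S1 by (simp add: path_sum_refl C_def)
  next
    case False
    have b: "1 \<le> m" "m < n" "1 \<le> l" "l \<le> k"
      using lm False by (auto simp: S1_def)
    have Q0: "Q n k l m x \<noteq> 0" "Q n k (l - 1) m x \<noteq> 0"
      using x lm by (auto simp: good_def)
    \<comment> \<open>For l = 1 the point (l - 1, m + 1) lies in row 0, which the induction never
      reaches; there no path counts in V and Q equals T.\<close>
    have Q1: "Q n k (l - 1) (m + 1) x \<noteq> 0"
    proof (cases "l = 1")
      case True
      then show ?thesis using V_none[of "m + 1" 0 x] Q_eq[of "m + 1" 0 x] b T by simp
    next
      case False
      then have "(l - 1, m + 1) \<in> S1 n k" using lm by (auto simp: S1_def)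
      then show ?thesis using x by (auto simp: good_def)
    qed
    have 1: "PS (l - 1) (m + 1) (transf x) = PS (l - 1) (m + 1) x * C / Q n k (l - 1) (m + 1) x"
      using less.hyps[of "m + 1" "l - 1"] b
      by (cases "(l - 1, m + 1) \<in> S1 n k") (auto simp: C_def path_sum_outside)
    have 2: "transf x l m / transf x l (m + 1) * PS l (m + 1) (transf x) =
        x l m / x l (m + 1) * Q n k (l - 1) m x * C * PS l (m + 1) x
          / (Q n k l m x * Q n k (l - 1) (m + 1) x)"
    proof (cases "(l, m + 1) \<in> S1 n k")
      case True
      then have "Q n k l (m + 1) x \<noteq> 0" "x l (m + 1) \<noteq> 0"
        using x by (auto simp: good_def torus_def)
      then show ?thesis
        using less.hyps[of "m + 1" l] b True lm Q0 Q1
        by (simp add: transf_def C_def field_simps)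
    qed (simp add: path_sum_outside)
    have "PS l m (transf x) = C * (x l m / x l (m + 1) * PS l (m + 1) x * Q n k (l - 1) m x
        + PS (l - 1) (m + 1) x * Q n k l m x) / (Q n k l m x * Q n k (l - 1) (m + 1) x)"
      unfolding path_sum_cons[OF lm False] 1 2 using Q0 Q1
      by (simp add: add_divide_distrib distrib_left mult_ac)
    also have "\<dots> = C * PS l m x / Q n k l m x"
      unfolding Q_exchange[OF lm False, symmetric] using Q0 Q1 by simp
    finally show ?thesis by (simp add: C_def)
  qed
qed

section \<open>\<Sigma> at the old and at the new point\<close>

lemma gam_0:
  assumes "good x"
  shows "gam n k 0 x = 1 / (x 1 n * x k 1)"
proof -
  have a: "PS k 1 x \<noteq> 0" "x 1 n \<noteq> 0" "x k 1 \<noteq> 0"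
    using good_T[OF assms] good_t[OF assms] by auto
  have "Sig n k x k 0 = 1 / x 1 n"
    using k assms by (auto simp: Sig_def S2_def X_def good_def torus_def S1_def)
  moreover have "Sig n k x k 1 = PS k 1 x"
  \<comment> \<open>For k = n the point (k, 1) is outside \<open>S2\<close>; the default value 1 of
    y agrees with the path sum.\<close>
  proof (cases "k = n")
    case True
    have "PS k 1 x = 1"
      using True k by (intro path_sum_last) auto
    then show ?thesis using True k by (simp add: Sig_def S2_def)
  next
    case False
    then show ?thesis
      using k assms corner_S1
      by (auto simp: Sig_def S2_def X_eq_path_sum X_def[of n k "k + 1"] good_def torus_def S1_def)
  qed
  moreover have "Sig n k x (k - 1) 1 = x k 1 / (x 1 n * PS k 1 x)"
  \<comment> \<open>For k = 1 the coordinate is again the default 1, and the right-hand side is 1 by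
    the telescoped row 1.\<close>
  proof (cases "k = 1")
    case True
    have "PS 1 1 x = x 1 1 / x 1 n"
      using path_sum_row_1[of x 1] True k assms unfolding good_def by simp
    then show ?thesis using True a k by (simp add: Sig_def S2_def)
  next
    case False
    then show ?thesis
      using k corner_S1 by (auto simp: Sig_def S2_def X_eq_path_sum X_def[of n k "k - 1"])
  qed
  ultimately show ?thesis
    using a by (simp add: gam_def Let_def power2_eq_square)
qed

lemma Sig_ne0:
  assumes "good x" "(l, m) \<in> S2 n k"
  shows "Sig n k x l m \<noteq> 0"
proof -
  have Xn: "X n k l m x \<noteq> 0" if "(l, m) \<in> S1 n k \<or> l = k + 1 \<or> l + m = k" for l m
  proof -
    consider "(l, m) \<in> S1 n k" | "l = k + 1" | "l + m = k" "l \<noteq> k + 1"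
      using \<open>_ \<or> _\<close> by blast
    then show ?thesis
    proof cases
      case 1
      then show ?thesis using assms by (auto simp: X_eq_path_sum good_def)
    qed (use good_t[OF assms(1)] in \<open>auto simp: X_def\<close>)
  qed
  have "x (l + 1) m \<noteq> 0"
    using assms by (auto simp: good_def torus_def) (metis zero_neq_one)
  moreover have "X n k l m x \<noteq> 0" "X n k (l + 1) m x \<noteq> 0"
    using assms(2) by (auto intro!: Xn simp: S1_def S2_def)
  ultimately show ?thesis using assms(2) by (simp add: Sig_def)
qed

lemma good_in_Sig_dom: "good x \<Longrightarrow> x \<in> Sig_dom n k"
  using Sig_ne0 by (auto simp: Sig_dom_def torus_def good_def) (auto simp: Sig_def)

lemma transf_torus: "good x \<Longrightarrow> transf x \<in> torus (S1 n k)"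
  by (auto simp: torus_def transf_def good_def)

text \<open>Since y^(k)_0 = 1 / x^(1)_n, the new value x^(k)_1 is the old one times t, which is
  exactly the change prescribed by \<open>crys_e\<close> for c = 1 / \<gamma>_0. At the other points
  of \<open>S2\<close> all factors Q and t T cancel.\<close>

lemma Sig_transf:
  assumes "good x"
  shows "Sig n k (transf x) l m = (if (l, m) = (k, 0) then x k 1 else Sig n k x l m)"
proof (cases "(l, m) \<in> S2 n k")
  case False
  then show ?thesis using k by (auto simp: Sig_def S2_def)
next
  case True
  then have b: "1 \<le> l" "l \<le> k" "k \<le> l + m" "l + m \<le> n" by (auto simp: S2_def)
  have t: "PS k 1 x \<noteq> 0" "x 1 n \<noteq> 0" "x k 1 \<noteq> 0"
    using good_T[OF assms] good_t[OF assms] by auto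
  have out: "x l m = 1" if "(l, m) \<notin> S1 n k" for l m
    using assms that by (auto simp: good_def torus_def)
  have ne: "PS l m x \<noteq> 0" "Q n k l m x \<noteq> 0" "Q n k (l - 1) m x \<noteq> 0" if "(l, m) \<in> S1 n k" for l m
    using assms that by (auto simp: good_def)
  have kk: "(k + 1, m) \<notin> S1 n k" by (simp add: S1_def)
  consider "l < k" "k < l + m" | "l < k" "l + m = k" | "l = k" "0 < m" | "l = k" "m = 0"
    using b by linarith
  then show ?thesis
  proof cases
    case 1
    then have s: "(l, m) \<in> S1 n k" "(l + 1, m) \<in> S1 n k"
      using b by (auto simp: S1_def)
    show ?thesis
      using True 1 s ne[OF s(1)] ne[OF s(2)] t path_sum_transf[OF assms s(1)] path_sum_transf[OF assms s(2)]
      by (simp add: Sig_def X_eq_path_sum transf_def)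
  next
    case 2
    then have s: "(l + 1, m) \<in> S1 n k" "(l, m) \<notin> S1 n k"
      using b by (auto simp: S1_def)
    \<comment> \<open>On l + m = k the convention X = 1 / x^(1)_n replaces the path sum. The new
      corner coordinate multiplies it by t, which compensates for the t in the denominator from
      \<open>path_sum_transf\<close>.\<close>
    have Ql: "Q n k l m x = PS k 1 x"
      using 2 b k Q_eq[of m l x] V_none[of m l x] by simp
    show ?thesis
      using True 2 s ne[OF s(1)] t path_sum_transf[OF assms s(1)] transf_corner[OF assms] Ql
      by (simp add: Sig_def X_eq_path_sum X_def[of n k l m] transf_def)
  next
    case 3
    then have s: "(k, m) \<in> S1 n k"
      using b k by (auto simp: S1_def)
    have "Q n k k m x = x 1 n * x k 1 * PS k 1 x"
      using 3 b k Q_eq[of m k x] V_all[of m k x] by (simp add: algebra_simps)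
    then show ?thesis
      using True 3 s ne[OF s(1)] t path_sum_transf[OF assms s(1)] kk
      by (simp add: Sig_def X_eq_path_sum X_def[of n k "k + 1"] transf_def out)
  next
    case 4
    then show ?thesis
      using True k kk t transf_corner[OF assms] by (simp add: Sig_def X_def transf_def)
  qed
qed

section \<open>Injectivity of \<Sigma>\<close>

lemma X_ne0:
  assumes "x \<in> Sig_dom n k" "(l, m) \<in> S1 n k"
  shows "X n k l m x \<noteq> 0"
proof -
  have "Sig n k x l m \<noteq> 0" if "(l, m) \<in> S2 n k" for l m
    using assms(1) that by (simp add: Sig_dom_def torus_def)
  \<comment> \<open>Division by 0 yields 0, so a nonzero coordinate of \<Sigma> forces its numerator
    and its denominator to be nonzero. Every point of \<open>S1\<close> except (1, n) occurs in one
    of the two places.\<close>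
  then have y: "X n k l m x \<noteq> 0" "X n k (l + 1) m x \<noteq> 0" if "(l, m) \<in> S2 n k" for l m
    using that by (fastforce simp: Sig_def)+
  consider "l = 1" "m = n" | "l = 1" "(l, m) \<in> S2 n k" | "(l - 1, m) \<in> S2 n k"
    using assms(2) by (cases "l = 1"; cases "m = n") (auto simp: S1_def S2_def)
  then show ?thesis
  proof cases
    case 1
    then show ?thesis using corner_S1 by (simp add: X_eq_path_sum path_sum_refl)
  qed (use y[of l m] y[of "l - 1" m] in simp_all)
qed

text \<open>This is \<open>path_sum_cons\<close> at (l + 1, m), with x expressed through y and X and
  the result divided by X^(l+1)_m X^(l)_(m+1). The case l + m = k is included, so the recursion
  starts from the convention 1 / x^(1)_n.\<close>

lemma inverse_X_recurrence:
  assumes x: "x \<in> Sig_dom n k" and l: "1 \<le> l" "l < k" and m: "k \<le> l + m" "l + m < n"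
  shows "1 / X n k l (m + 1) x =
    1 / X n k (l + 1) m x + Sig n k x l m / Sig n k x l (m + 1) / X n k l m x"
proof -
  have s: "(l + 1, m) \<in> S1 n k" "(l + 1, m + 1) \<in> S1 n k" "(l, m + 1) \<in> S1 n k"
    "(l, m) \<in> S2 n k" "(l, m + 1) \<in> S2 n k"
    using l m by (auto simp: S1_def S2_def)
  have ne: "X n k (l + 1) m x \<noteq> 0" "X n k (l + 1) (m + 1) x \<noteq> 0" "X n k l (m + 1) x \<noteq> 0"
    using X_ne0[OF x s(1)] X_ne0[OF x s(2)] X_ne0[OF x s(3)] .
  have tx: "x (l + 1) m \<noteq> 0" "x (l + 1) (m + 1) \<noteq> 0"
    using x s by (auto simp: Sig_dom_def torus_def)
  have "Sig n k x l m \<noteq> 0" using x s by (auto simp: Sig_dom_def torus_def)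
  then have n0: "X n k l m x \<noteq> 0" using s by (auto simp: Sig_def)
  have "X n k (l + 1) m x =
      x (l + 1) m / x (l + 1) (m + 1) * X n k (l + 1) (m + 1) x + X n k l (m + 1) x"
    using s l m path_sum_cons[OF s(1), of "(1, n)" x] by (simp add: X_eq_path_sum)
  then show ?thesis
    using s tx ne n0 by (simp add: Sig_def divide_simps)
qed

lemma inj_Sig: "inj_on (Sig n k) (Sig_dom n k)"
proof (rule inj_onI)
  fix x z assume x: "x \<in> Sig_dom n k" and z: "z \<in> Sig_dom n k" and eq: "Sig n k x = Sig n k z"
  have out: "x l m = 1" "z l m = 1" if "(l, m) \<notin> S1 n k" for l m
    using x z that by (auto simp: Sig_dom_def torus_def)
  have ne: "x l m \<noteq> 0" "z l m \<noteq> 0" if "(l, m) \<in> S1 n k" for l m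
    using x z that by (auto simp: Sig_dom_def torus_def)
  \<comment> \<open>All these values equal y^(k)_0.\<close>
  have corner: "X n k l m x = X n k l m z" if "l \<le> k" "l + m = k" for l m
    using fun_cong[OF fun_cong[OF eq], of k 0] k that
    by (auto simp: Sig_def S2_def X_def out S1_def)
  have x1n: "x 1 n = z 1 n"
    using corner[of 1 "k - 1"] k ne corner_S1 by (simp add: X_def)
  have last: "X n k l m w = 1" if "1 \<le> l" "l \<le> k" "l + m = n + 1" for l m w
    using path_sum_last[OF that, of w] that k by (simp add: X_eq_path_sum S1_def)
  \<comment> \<open>Row k of X is read off from y; the rows below follow downwards, each from left
    to right by the recurrence, starting at l + m = k.\<close>
  have X_eq: "X n k l m x = X n k l m z" if "1 \<le> l" "l \<le> k" "k \<le> l + m" "l + m \<le> n + 1" for l m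
    using that(2,1,3,4)
  proof (induction l arbitrary: m rule: int_le_induct)
    case base
    show ?case
    proof (cases "m = n + 1 - k")
      case True
      then show ?thesis using last[of k m] k by simp
    next
      case False
      then show ?thesis
        using fun_cong[OF fun_cong[OF eq], of k m] base k
        by (auto simp: Sig_def S2_def X_def[of n k "k + 1"] out S1_def)
    qed
  next
    case (step l)
    note upper = step.IH
    have l: "1 \<le> l - 1" "l - 1 < k" using step by auto
    have "k - (l - 1) \<le> m" using step by simp
    then show ?case using step.prems(3)
    proof (induction m rule: int_ge_induct)
      case base
      then show ?case using corner step by simp
    next
      case (step m)
      show ?case
      proof (cases "l - 1 + m = n")
        case True
        then show ?thesis using last[of "l - 1" "m + 1"] l by simp
      next
        case False
        then have m: "k \<le> l - 1 + m" "l - 1 + m < n" using step by auto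
        have "X n k l m x = X n k l m z"
          using upper[of m] l m by simp
        moreover have "X n k (l - 1) m x = X n k (l - 1) m z"
          using step m by simp
        ultimately have "1 / X n k (l - 1) (m + 1) x = 1 / X n k (l - 1) (m + 1) z"
          using inverse_X_recurrence[OF x l m] inverse_X_recurrence[OF z l m] eq by simp
        then show ?thesis by simp
      qed
    qed
  qed
  have row1: "X n k 1 m w = w 1 m / w 1 n" if "k \<le> m" "m \<le> n" "w \<in> Sig_dom n k" for m w
    using path_sum_row_1[of w m] that k by (simp add: X_eq_path_sum S1_def Sig_dom_def)
  \<comment> \<open>Once X is known, row 1 of x comes from the telescoped path sums and every higher
    row from the definition of \<Sigma>.\<close>
  show "x = z"
  proof (intro ext)
    fix l m
    consider "(l, m) \<notin> S1 n k" | "l = 1" "(l, m) \<in> S1 n k" | "l \<noteq> 1" "(l, m) \<in> S1 n k"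
      by blast
    then show "x l m = z l m"
    proof cases
      case 1
      then show ?thesis by (simp add: out)
    next
      case 2
      then have "X n k 1 m x = X n k 1 m z" "k \<le> m" "m \<le> n"
        using X_eq[of 1 m] by (auto simp: S1_def)
      then show ?thesis
        using 2 row1[OF _ _ x] row1[OF _ _ z] x1n ne corner_S1 by simp
    next
      case 3
      then have s: "(l - 1, m) \<in> S2 n k" by (auto simp: S1_def S2_def)
      have "X n k (l - 1) m x = X n k (l - 1) m z" "X n k l m x = X n k l m z"
        using 3 X_eq by (auto simp: S1_def)
      moreover have "Sig n k x (l - 1) m \<noteq> 0"
        using x s by (auto simp: Sig_dom_def torus_def)
      moreover have "Sig n k x (l - 1) m = Sig n k z (l - 1) m" using eq by simp
      ultimately show ?thesis using s by (auto simp: Sig_def)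
    qed
  qed
qed

text \<open>\<open>the_inv_into\<close> is controlled only on the image of \<open>Sig_dom\<close>,
  so \<open>transf x\<close> must first be shown to lie in that domain; injectivity then identifies
  it with the preimage of y'.\<close>

lemma refl_s_0:
  assumes "good x"
  shows "refl_s n k 0 x = transf x"
proof -
  have t: "x 1 n \<noteq> 0" "x k 1 \<noteq> 0"
    using good_t[OF assms] by auto
  have y: "Sig n k x k 0 = 1 / x 1 n"
    using k assms by (auto simp: Sig_def S2_def X_def good_def torus_def S1_def)
  have "Sig n k (transf x) \<in> torus (S2 n k)"
    using good_in_Sig_dom[OF assms] t k
    by (auto simp: Sig_dom_def torus_def Sig_transf[OF assms] S2_def)
  then have dom: "transf x \<in> Sig_dom n k"
    using transf_torus[OF assms] by (simp add: Sig_dom_def)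
  have "(\<lambda>l m. if (l, m) = (k, 0) then inverse (gam n k 0 x) * Sig n k x k 0 else Sig n k x l m)
      = Sig n k (transf x)"
    using t by (intro ext) (auto simp: Sig_transf[OF assms] gam_0[OF assms] y)
  then show ?thesis
    using the_inv_into_f_f[OF inj_Sig dom]
    by (simp add: refl_s_def crys_e_def Sig_inv_def Let_def)
qed

end

section \<open>Regular functions on the torus\<close>

text \<open>\<open>regular_fun\<close> only admits coordinates indexed by \<open>S\<close>; on the torus the remaining ones are the
  constant 1.\<close>

definition regular_on_torus :: "(int \<times> int) set \<Rightarrow> (point \<Rightarrow> complex) \<Rightarrow> bool" where
  "regular_on_torus S g \<longleftrightarrow> (\<exists>f. regular_fun S f \<and> (\<forall>x\<in>torus S. f x = g x))"

named_theorems regular_intros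

lemma regular_const [regular_intros]: "regular_on_torus S (\<lambda>x. c)"
  unfolding regular_on_torus_def using regular_fun.const by blast

lemma regular_coord [regular_intros]: "regular_on_torus S (\<lambda>x. x l m)"
proof (cases "(l, m) \<in> S")
  case True
  then show ?thesis unfolding regular_on_torus_def using regular_fun.coord by blast
next
  case False
  then show ?thesis unfolding regular_on_torus_def
    by (intro exI[of _ "\<lambda>x. 1"]) (auto simp: regular_fun.const torus_def)
qed

lemma regular_inverse_coord: "regular_on_torus S (\<lambda>x. 1 / x l m)"
proof (cases "(l, m) \<in> S")
  case True
  then show ?thesis unfolding regular_on_torus_def using regular_fun.inv_coord by blast
next
  case False
  then show ?thesis unfolding regular_on_torus_def
    by (intro exI[of _ "\<lambda>x. 1"]) (auto simp: regular_fun.const torus_def)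
qed

lemma regular_add [regular_intros]:
  "regular_on_torus S f \<Longrightarrow> regular_on_torus S g \<Longrightarrow> regular_on_torus S (\<lambda>x. f x + g x)"
  unfolding regular_on_torus_def by (metis (no_types, lifting) regular_fun.add)

lemma regular_mult [regular_intros]:
  "regular_on_torus S f \<Longrightarrow> regular_on_torus S g \<Longrightarrow> regular_on_torus S (\<lambda>x. f x * g x)"
  unfolding regular_on_torus_def by (metis (no_types, lifting) regular_fun.mult)

lemma regular_sum [regular_intros]:
  "(\<And>i. i \<in> A \<Longrightarrow> regular_on_torus S (f i)) \<Longrightarrow> regular_on_torus S (\<lambda>x. \<Sum>i\<in>A. f i x)"
  by (induction A rule: infinite_finite_induct) (auto intro!: regular_intros)

lemma regular_prod [regular_intros]:
  "(\<And>i. i \<in> A \<Longrightarrow> regular_on_torus S (f i)) \<Longrightarrow> regular_on_torus S (\<lambda>x. \<Prod>i\<in>A. f i x)"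
  by (induction A rule: infinite_finite_induct) (auto intro!: regular_intros)

lemma regular_power [regular_intros]:
  "regular_on_torus S f \<Longrightarrow> regular_on_torus S (\<lambda>x. f x ^ e)"
  by (induction e) (auto intro!: regular_intros)

lemma inverse_prod_complex: "1 / (\<Prod>i\<in>A. f i :: complex) = (\<Prod>i\<in>A. 1 / f i)"
  by (simp add: prod_dividef)

text \<open>The point of the torus with all coordinates 1 witnesses nonemptiness of the open sets below:
  the regular functions in question are sums of monomials with positive coefficients.\<close>

abbreviation one_point :: point where
  "one_point \<equiv> \<lambda>l m. 1"

text \<open>Finitely many nonvanishing conditions are merged into one by taking the product.\<close>

lemma genericallyI:
  assumes "finite A" "\<And>i. i \<in> A \<Longrightarrow> regular_on_torus S (g i)" "\<And>i. i \<in> A \<Longrightarrow> g i one_point \<noteq> 0"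
    and "\<And>x. x \<in> torus S \<Longrightarrow> (\<And>i. i \<in> A \<Longrightarrow> g i x \<noteq> 0) \<Longrightarrow> P x"
  shows "generically S P"
proof -
  have "regular_on_torus S (\<lambda>x. \<Prod>i\<in>A. g i x)"
    by (intro regular_prod assms)
  then obtain f where f: "regular_fun S f" "\<And>x. x \<in> torus S \<Longrightarrow> f x = (\<Prod>i\<in>A. g i x)"
    unfolding regular_on_torus_def by blast
  have "one_point \<in> torus S" by (simp add: torus_def)
  moreover from this have "f one_point \<noteq> 0" using f assms by simp
  moreover have "P x" if "x \<in> torus S" "f x \<noteq> 0" for x
    using that f assms by simp
  ultimately show ?thesis unfolding generically_def using f by blast
qed

section \<open>Regularity, and nonvanishing at the point with all coordinates 1\<close>

lemma regular_path_weight: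
  "regular_on_torus S (\<lambda>x. path_weight x ps)"
proof (induction ps rule: induct_list012)
  case (3 p q ps)
  obtain i j i' j' where pq: "p = (i, j)" "q = (i', j')" by (cases p; cases q) auto
  have "regular_on_torus S (\<lambda>x. x i j / x i (j + 1))"
    using regular_mult[OF regular_coord regular_inverse_coord] by simp
  then have "regular_on_torus S (\<lambda>x. step_weight x p q)"
    using regular_const[of S 1] by (cases "i' = i") (simp_all add: pq)
  then show ?case using 3 by (auto intro: regular_intros)
qed (auto intro: regular_intros)

lemma regular_path_sum [regular_intros]: "regular_on_torus S (path_sum n k p q)"
  unfolding path_sum_def by (intro regular_intros regular_path_weight)

lemma regular_Q [regular_intros]: "regular_on_torus S (Q n k l m)"
  unfolding Q_def U_def V_def by (intro regular_intros regular_path_weight)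

lemma regular_inverse_D: "regular_on_torus S (\<lambda>x. 1 / D n k i p x)"
proof -
  let ?b = "row_hi n k i"
  have "1 / D n k i p x = (1 / x p i) * (\<Prod>j=p+1..?b. (1 / x j i)^2) *
      ((\<Prod>j=p+1..?b+1. x j (i - 1)) * (\<Prod>j=p..?b. x j (i + 1)))" for x
    unfolding D_def Let_def by (simp add: power_one_over inverse_prod_complex[symmetric])
  then show ?thesis by (simp only:) (intro regular_intros regular_inverse_coord)
qed

lemma regular_F: "regular_on_torus S (F k i p)"
proof -
  let ?a = "row_lo k i"
  have "F k i p x = x p i * (\<Prod>j=?a..p-1. x j i)^2 *
      ((\<Prod>j=?a..p. 1 / x j (i - 1)) * (\<Prod>j=?a-1..p-1. 1 / x j (i + 1)))" for x
    unfolding F_def Let_def by (simp add: inverse_prod_complex[symmetric])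
  then have "regular_on_torus S (\<lambda>x. F k i p x)"
    by (simp only:) (intro regular_intros regular_inverse_coord)
  then show ?thesis by simp
qed

lemma path_weight_one: "path_weight one_point ps = 1"
proof (induction ps rule: induct_list012)
  case (3 p q ps)
  then show ?case by (cases p; cases q) auto
qed auto

text \<open>A point with l + m \<le> n can move right, and one with l + m = n + 1 and l > 1 can move
  diagonally. All weights are 1 at \<open>one_point\<close>, so path sums there count paths and are
  positive.\<close>

lemma (in crystal) paths_to_corner_nonempty: "(l, m) \<in> S1 n k \<Longrightarrow> paths n k (l, m) (1, n) \<noteq> {}"
proof (induction "nat (n - m)" arbitrary: l m rule: less_induct)
  case less
  show ?case
  proof (cases "(l, m) = (1, n)")
    case True
    then show ?thesis using paths_refl corner_S1 by simp
  next
    case False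
    then have "m < n" using less.prems by (auto simp: S1_def)
    moreover have "(l, m + 1) \<in> S1 n k \<or> (l - 1, m + 1) \<in> S1 n k"
      using less.prems False by (auto simp: S1_def)
    ultimately show ?thesis
      using less.hyps[of "m + 1" l] less.hyps[of "m + 1" "l - 1"]
      by (auto simp: paths_cons[OF less.prems False])
  qed
qed

lemma (in crystal) PS_one: "(l, m) \<in> S1 n k \<Longrightarrow> PS l m one_point \<noteq> 0"
  using paths_to_corner_nonempty by (simp add: path_sum_def path_weight_one finite_paths)

lemma (in crystal) generically_good: "generically (S1 n k) good"
proof (rule genericallyI[where A = "S1 n k" and
      g = "\<lambda>(l, m) x. PS l m x * Q n k l m x * Q n k (l - 1) m x"])
  fix p assume p: "p \<in> S1 n k"
  show "regular_on_torus (S1 n k) ((\<lambda>(l, m) x. PS l m x * Q n k l m x * Q n k (l - 1) m x) p)"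
    by (cases p) (auto intro!: regular_intros)
  obtain l m where lm: "p = (l, m)" by (cases p)
  then have "1 \<le> m" "m \<le> n" "0 \<le> l - 1" "l \<le> k" using p by (auto simp: S1_def)
  \<comment> \<open>At \<open>one_point\<close> the factor t - 1 in \<open>Q_eq\<close>
    vanishes.\<close>
  then have "Q n k l m one_point = PS k 1 one_point" "Q n k (l - 1) m one_point = PS k 1 one_point"
    using Q_eq[of m l one_point] Q_eq[of m "l - 1" one_point] by auto
  then show "(\<lambda>(l, m) x. PS l m x * Q n k l m x * Q n k (l - 1) m x) p one_point \<noteq> 0"
    using p lm PS_one corner_S1 by simp
next
  show "\<And>x. x \<in> torus (S1 n k) \<Longrightarrow>
    (\<And>p. p \<in> S1 n k \<Longrightarrow> (\<lambda>(l, m) x. PS l m x * Q n k l m x * Q n k (l - 1) m x) p x \<noteq> 0) \<Longrightarrow> good x"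
    unfolding good_def by fastforce
qed (rule finite_S1)

section \<open>The reflections for \<open>1 \<le> i\<close>\<close>

lemma in_column_iff: "(l, i) \<in> S1 n k \<longleftrightarrow> row_lo k i \<le> l \<and> l \<le> row_hi n k i"
  by (auto simp: S1_def row_lo_def row_hi_def)

lemma F_eq_gam_over_D:
  assumes x: "x \<in> torus (S1 n k)" and i: "1 \<le> i"
    and p: "row_lo k i \<le> p" "p \<le> row_hi n k i"
  shows "F k i p x = gam n k i x * (1 / D n k i p x)"
proof -
  define a where "a = row_lo k i"
  define b where "b = row_hi n k i"
  \<comment> \<open>Interval products are kept opaque, so that they can be cut by
    \<open>split\<close> and cancelled as nonzero atoms.\<close>
  define q where "q = (\<lambda>f :: int \<Rightarrow> complex. \<lambda>i j. \<Prod>l=i..j. f l)"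
  have ne: "q (\<lambda>j. x j m) i j \<noteq> 0" for m i j
    using torus_ne0[OF x] by (simp add: q_def)
  have split: "q f i j = q f i l * q f (l + 1) j" if "i \<le> l + 1" "l \<le> j" for f i l j
  proof -
    have "{i..j} = {i..l} \<union> {l + 1..j}" using that by auto
    then show ?thesis unfolding q_def by (simp add: prod.union_disjoint)
  qed
  have sq: "q (\<lambda>j. (x j i)\<^sup>2) i' j' = (q (\<lambda>j. x j i) i' j')\<^sup>2" for i' j'
    by (simp add: q_def prod_power_distrib)
  have single: "q f i i = f i" for f i by (simp add: q_def)
  have ab: "a \<le> p" "p \<le> b" using p by (simp_all add: a_def b_def)
  \<comment> \<open>The products in \<gamma>_i run over full columns. Each is cut at p: the left
    pieces form \<open>F\<close>, the right pieces form \<open>D\<close>, and the factor x^(p)_i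
    belongs to both, which the square in \<gamma>_i provides.\<close>
  have e1: "q (\<lambda>j. x j i) (a + 1) b * x a i = q (\<lambda>j. x j i) a (p - 1) * x p i * q (\<lambda>j. x j i) (p + 1) b"
    using split[of a a b "\<lambda>j. x j i"] split[of a "p - 1" b "\<lambda>j. x j i"] split[of p p b "\<lambda>j. x j i"] ab
    by (simp add: single mult_ac)
  have e2: "q (\<lambda>j. x j (i - 1)) (a + 1) (b + 1) * x a (i - 1) =
      q (\<lambda>j. x j (i - 1)) a p * q (\<lambda>j. x j (i - 1)) (p + 1) (b + 1)"
    using split[of a a "b + 1" "\<lambda>j. x j (i - 1)"] split[of a p "b + 1" "\<lambda>j. x j (i - 1)"] ab
    by (simp add: single mult_ac)
  have e3: "q (\<lambda>j. x j (i + 1)) a b * x (a - 1) (i + 1) =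
      q (\<lambda>j. x j (i + 1)) (a - 1) (p - 1) * q (\<lambda>j. x j (i + 1)) p b"
    using split[of "a - 1" "a - 1" b "\<lambda>j. x j (i + 1)"]
      split[of "a - 1" "p - 1" b "\<lambda>j. x j (i + 1)"] ab
    by (simp add: single mult_ac)
  have D: "D n k i l x = x l i * (q (\<lambda>j. x j i) (l + 1) b)\<^sup>2 /
      (q (\<lambda>j. x j (i - 1)) (l + 1) (b + 1) * q (\<lambda>j. x j (i + 1)) l b)" for l
    unfolding sq[symmetric] by (simp add: D_def Let_def b_def q_def)
  have "gam n k i x = (q (\<lambda>j. x j i) (a + 1) b * x a i)\<^sup>2 /
      ((q (\<lambda>j. x j (i - 1)) (a + 1) (b + 1) * x a (i - 1)) * (q (\<lambda>j. x j (i + 1)) a b * x (a - 1) (i + 1)))"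
    using i by (simp add: gam_def Let_def a_def[symmetric] D power2_eq_square mult_ac)
  also have "\<dots> = (q (\<lambda>j. x j i) a (p - 1) * x p i * q (\<lambda>j. x j i) (p + 1) b)\<^sup>2 /
      ((q (\<lambda>j. x j (i - 1)) a p * q (\<lambda>j. x j (i - 1)) (p + 1) (b + 1)) *
       (q (\<lambda>j. x j (i + 1)) (a - 1) (p - 1) * q (\<lambda>j. x j (i + 1)) p b))"
    unfolding e1 e2 e3 ..
  finally have gam: "gam n k i x = \<dots>" .
  have F: "F k i p x = x p i * (q (\<lambda>j. x j i) a (p - 1))\<^sup>2 /
      (q (\<lambda>j. x j (i - 1)) a p * q (\<lambda>j. x j (i + 1)) (a - 1) (p - 1))"
    by (simp add: F_def Let_def a_def q_def)
  have cancel: "u * A\<^sup>2 / (C * G) = (A * u * B)\<^sup>2 / ((C * E) * (G * H)) * (1 / (u * B\<^sup>2 / (E * H)))"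
    if "u \<noteq> 0" "B \<noteq> 0" "E \<noteq> 0" "H \<noteq> 0" for A B C E G H u :: complex
    using that by (simp add: power2_eq_square)
  show ?thesis
    unfolding F gam D by (rule cancel[OF torus_ne0[OF x] ne ne ne])
qed

lemma gam_ne0:
  assumes "x \<in> torus (S1 n k)" "1 \<le> i"
  shows "gam n k i x \<noteq> 0"
  using torus_ne0[OF assms(1)] assms(2) by (simp add: gam_def D_def Let_def)

lemma refl_s_eq:
  assumes x: "x \<in> torus (S1 n k)" and i: "1 \<le> i" and l: "(l, i) \<in> S1 n k"
  defines "a \<equiv> row_lo k i" and "b \<equiv> row_hi n k i"
  shows "refl_s n k i x l i =
    x l i * (((\<Sum>p=a..l-1. F k i p x) + (\<Sum>p=l..b. 1 / D n k i p x))
      / ((\<Sum>p=a..l. F k i p x) + (\<Sum>p=l+1..b. 1 / D n k i p x)))"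
proof -
  define g where "g = gam n k i x"
  have g: "g \<noteq> 0" using gam_ne0[OF x i] by (simp add: g_def)
  have ab: "a \<le> l" "l \<le> b" using l in_column_iff by (auto simp: a_def b_def)
  have F: "(\<Sum>p=a..j. F k i p x) = g * (\<Sum>p=a..j. 1 / D n k i p x)" if "j \<le> b" for j
    unfolding sum_distrib_left g_def
    using F_eq_gam_over_D[OF x i] that by (intro sum.cong) (auto simp: a_def b_def)
  define N where "N = (\<Sum>p=a..l-1. 1 / D n k i p x) + (\<Sum>p=l..b. inverse g / D n k i p x)"
  define M where "M = (\<Sum>p=a..l. 1 / D n k i p x) + (\<Sum>p=l+1..b. inverse g / D n k i p x)"
  \<comment> \<open>Here c = 1 / g, so multiplication by g removes c from these terms and turns the
    others into \<open>F\<close>.\<close>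
  have G: "g * (\<Sum>p=j..b. inverse g / D n k i p x) = (\<Sum>p=j..b. 1 / D n k i p x)" for j
    unfolding sum_distrib_left using g by (intro sum.cong) auto
  have N: "(\<Sum>p=a..l-1. F k i p x) + (\<Sum>p=l..b. 1 / D n k i p x) = g * N"
    and M: "(\<Sum>p=a..l. F k i p x) + (\<Sum>p=l+1..b. 1 / D n k i p x) = g * M"
    using ab F unfolding N_def M_def distrib_left G by auto
  have "refl_s n k i x l i = x l i * N / M"
    unfolding N_def M_def using i l
    by (simp only: refl_s_def crys_e_def Let_def a_def b_def g_def) simp
  then show ?thesis unfolding N M using g by simp
qed

lemma generically_refl_s:
  fixes n k i :: int
  assumes i: "1 \<le> i"
  defines "a \<equiv> row_lo k i" and "b \<equiv> row_hi n k i"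
  shows "generically (S1 n k) (\<lambda>x. refl_s n k i x \<in> torus (S1 n k) \<and>
    (\<forall>(l, m)\<in>S1 n k. refl_s n k i x l m =
      (if m = i then
        x l i * (((\<Sum>p=a..l-1. F k i p x) + (\<Sum>p=l..b. 1 / D n k i p x))
          / ((\<Sum>p=a..l. F k i p x) + (\<Sum>p=l+1..b. 1 / D n k i p x)))
       else x l m)))"
proof -
  define N where "N = (\<lambda>l x. (\<Sum>p=a..l-1. F k i p x) + (\<Sum>p=l..b. 1 / D n k i p x))"
  define M where "M = (\<lambda>l x. (\<Sum>p=a..l. F k i p x) + (\<Sum>p=l+1..b. 1 / D n k i p x))"
  have one: "D n k i p one_point = 1" "F k i p one_point = 1" for p
    by (simp_all add: D_def F_def Let_def)
  show ?thesis
  proof (rule genericallyI[where A = "{a..b}" and g = "\<lambda>l x. N l x * M l x"])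
    fix l assume l: "l \<in> {a..b}"
    show "regular_on_torus (S1 n k) (\<lambda>x. N l x * M l x)"
      unfolding N_def M_def by (intro regular_intros regular_F regular_inverse_D)
    \<comment> \<open>At \<open>one_point\<close> every summand is 1, so both sums count their
      terms.\<close>
    have "N l one_point = of_nat (nat (l - a) + nat (b - l + 1))"
      "M l one_point = of_nat (nat (l + 1 - a) + nat (b - l))"
      by (simp_all add: N_def M_def one)
    moreover have "nat (l - a) + nat (b - l + 1) \<noteq> 0" "nat (l + 1 - a) + nat (b - l) \<noteq> 0"
      using l by auto
    ultimately show "N l one_point * M l one_point \<noteq> 0"
      by (metis mult_eq_0_iff of_nat_eq_0_iff)
  next
    fix x assume x: "x \<in> torus (S1 n k)" and ne: "\<And>l. l \<in> {a..b} \<Longrightarrow> N l x * M l x \<noteq> 0"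
    have eq: "refl_s n k i x l m = (if m = i then x l i * (N l x / M l x) else x l m)"
      if "(l, m) \<in> S1 n k" for l m
    proof (cases "m = i")
      case True
      then show ?thesis
        using refl_s_eq[OF x i, of l] that by (simp add: N_def M_def a_def b_def)
    next
      case False
      then show ?thesis using i by (simp add: refl_s_def crys_e_def Let_def)
    qed
    have out: "refl_s n k i x l m = x l m" if "(l, m) \<notin> S1 n k" for l m
      using i that by (simp add: refl_s_def crys_e_def Let_def)
    have "refl_s n k i x \<in> torus (S1 n k)"
      unfolding torus_def
    proof (intro CollectI allI)
      fix l m
      show "if (l, m) \<in> S1 n k then refl_s n k i x l m \<noteq> 0 else refl_s n k i x l m = 1"
      proof (cases "(l, m) \<in> S1 n k")
        case True
        then show ?thesis
          using eq ne[of l] torus_ne0[OF x] in_column_iff[of l i] by (auto simp: a_def b_def)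
      next
        case False
        then show ?thesis using out x by (auto simp: torus_def)
      qed
    qed
    then show "refl_s n k i x \<in> torus (S1 n k) \<and>
        (\<forall>(l, m)\<in>S1 n k. refl_s n k i x l m =
          (if m = i then
            x l i * (((\<Sum>p=a..l-1. F k i p x) + (\<Sum>p=l..b. 1 / D n k i p x))
              / ((\<Sum>p=a..l. F k i p x) + (\<Sum>p=l+1..b. 1 / D n k i p x)))
           else x l m))"
      using eq by (auto simp: N_def M_def)
  qed simp
qed

theorem theorem8p2:
  fixes n k :: int
  assumes "2 \<le> n" and "1 \<le> k" and "k \<le> n"
  shows "(\<forall>i\<in>{1..n}. generically (S1 n k) (\<lambda>x.
           refl_s n k i x \<in> torus (S1 n k) \<and>
           (\<forall>(l, m)\<in>S1 n k. refl_s n k i x l m =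
             (let a = row_lo k i; b = row_hi n k i in
              if m = i then
                x l i * (((\<Sum>p=a..l-1. F k i p x) + (\<Sum>p=l..b. 1 / D n k i p x))
                       / ((\<Sum>p=a..l. F k i p x) + (\<Sum>p=l+1..b. 1 / D n k i p x)))
              else x l m))))
       \<and> generically (S1 n k) (\<lambda>x.
           refl_s n k 0 x \<in> torus (S1 n k) \<and>
           (\<forall>(l, m)\<in>S1 n k. refl_s n k 0 x l m =
             (if (l, m) \<noteq> (1, n) then
                x l m * ((U n k (l - 1) m x + x 1 n * x k 1 * V n k l m x)
                       / (U n k l m x + x 1 n * x k 1 * V n k (l + 1) m x))
              else 1 / x k 1)))"
proof (intro conjI ballI)
  interpret crystal n k using assms by unfold_locales
  show "generically (S1 n k) (\<lambda>x.
           refl_s n k i x \<in> torus (S1 n k) \<and>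
           (\<forall>(l, m)\<in>S1 n k. refl_s n k i x l m =
             (let a = row_lo k i; b = row_hi n k i in
              if m = i then
                x l i * (((\<Sum>p=a..l-1. F k i p x) + (\<Sum>p=l..b. 1 / D n k i p x))
                       / ((\<Sum>p=a..l. F k i p x) + (\<Sum>p=l+1..b. 1 / D n k i p x)))
              else x l m)))" if "i \<in> {1..n}" for i
    using generically_refl_s[of i] that by (simp add: Let_def)
  have "refl_s n k 0 x \<in> torus (S1 n k) \<and>
      (\<forall>(l, m)\<in>S1 n k. refl_s n k 0 x l m =
        (if (l, m) \<noteq> (1, n) then
           x l m * ((U n k (l - 1) m x + x 1 n * x k 1 * V n k l m x)
             / (U n k l m x + x 1 n * x k 1 * V n k (l + 1) m x))
         else 1 / x k 1))" if x: "good x" for x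
    using transf_torus[OF x] transf_corner[OF x]
    by (auto simp: refl_s_0[OF x]) (auto simp: transf_def Q_def)
  then show "generically (S1 n k) (\<lambda>x.
           refl_s n k 0 x \<in> torus (S1 n k) \<and>
           (\<forall>(l, m)\<in>S1 n k. refl_s n k 0 x l m =
             (if (l, m) \<noteq> (1, n) then
                x l m * ((U n k (l - 1) m x + x 1 n * x k 1 * V n k l m x)
                       / (U n k l m x + x 1 n * x k 1 * V n k (l + 1) m x))
              else 1 / x k 1)))"
    using generically_good unfolding generically_def by blast
qed

end
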